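(* Let $\Sigma = \{\exists,\forall\}\times\{0,1\}$, and let $W_{0,1}, W_{0,1}' \subseteq T_\Sigma$ be the game tree languages defined in the context. Then $W_{0,1}$ and $W_{0,1}'$ cannot be separated by any Borel set; that is, there is no Borel set $C \subseteq T_\Sigma$ such that $W_{0,1} \subseteq C \subseteq T_\Sigma \setminus W_{0,1}'$.
   Context: Trees. For a finite alphabet $\Sigma$, a (full binary) tree over $\Sigma$ is a mapping $t:\{1,2\}^*\to\Sigma$, and $T_\Sigma$ is the set of all such trees. $T_\Sigma$ carries the topology induced by the metric $d(t_1,t_2)=0$ if $t_1=t_2$, and $d(t_1,t_2)=2^{-n}$ with $n=\min\{|w| : t_1(w)\neq t_2(w)\}$ otherwise. Borel sets are the members of the least family of subsets of $T_\Sigma$ containing the open sets and closed under complement and countable union. Games. Let $\Sigma=\{\exists,\forall\}\times\{0,1\}$ and let $\pi_i$ be the projection on the $i$-th component ($i=1,2$). With each $t\in T_\Sigma$ associate a game $G(t)$ between two players, Eve and Adam. Positions are the nodes $v\in\{1,2\}^*$; $v$ belongs to Eve if $\pi_1(t(v))=\exists$, and to Adam otherwise. From $v$ the owner of $v$ chooses a move to one of the successors $v1$, $v2$. A play starts at the root (empty word) and forms an infinite path $P=p_0p_1p_2\ldots\in\{1,2\}^\omega$. The play is won by Eve if $\limsup_{n\to\infty}\pi_2(t(p_0p_1\ldots p_n))=0$ (i.e. $1$ occurs only finitely often); otherwise Adam wins. A strategy for a player selects a move at each of that player's positions; it is winning if every play consistent with it is won by that player. Languages. $W_{0,1}$ is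 the set of all $t\in T_\Sigma$ such that Eve has a winning strategy in $G(t)$. $W_{0,1}'$ is the set of all $t\in T_\Sigma$ such that Adam has a strategy in $G(t)$ for which every consistent play satisfies $\liminf_{n\to\infty}\pi_2(t(p_0p_1\ldots p_n))=1$ (i.e. $0$ occurs only finitely often). *)

theory Defs
  imports "HOL-Analysis.Abstract_Metric_Spaces" "HOL-Library.Liminf_Limsup"
    "HOL-Library.Extended_Nat" "HOL-Analysis.Sigma_Algebra"
begin

datatype dir = D1 | D2

type_synonym 'a tree = "dir list \<Rightarrow> 'a"

definition trees :: "'a set \<Rightarrow> 'a tree set" where
  "trees A = {t. \<forall>w. t w \<in> A}"

definition tree_dist :: "'a tree \<Rightarrow> 'a tree \<Rightarrow> real" where
  "tree_dist s t =
     (if s = t then 0 else 1 / 2 ^ (LEAST n. \<exists>w. length w = n \<and> s w \<noteq> t w))"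

lemma tree_dist_less_iff:
  "tree_dist s t < 1 / 2 ^ n \<longleftrightarrow> (\<forall>w. length w \<le> n \<longrightarrow> s w = t w)"
proof (cases "s = t")
  case True
  then show ?thesis by (simp add: tree_dist_def)
next
  case False
  let ?Q = "\<lambda>k. \<exists>w. length w = k \<and> s w \<noteq> t w"
  define m where "m = (LEAST k. ?Q k)"
  from False obtain w0 where "s w0 \<noteq> t w0" by blast
  then have "?Q (length w0)" by blast
  then have ex: "?Q m" unfolding m_def by (rule LeastI[of ?Q])
  have le: "m \<le> length w" if "s w \<noteq> t w" for w
    unfolding m_def by (rule Least_le[of ?Q]) (use that in blast)
  have "tree_dist s t < 1 / 2 ^ n \<longleftrightarrow> n < m"
    using False by (simp add: tree_dist_def m_def field_simps)
  also have "\<dots> \<longleftrightarrow> (\<forall>w. length w \<le> n \<longrightarrow> s w = t w)"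
    using ex le by (metis leD leI le_less_trans)
  finally show ?thesis .
qed

lemma Metric_space_tree_dist: "Metric_space M tree_dist"
proof
  fix s t u :: "'a tree"
  show "0 \<le> tree_dist s t" by (simp add: tree_dist_def)
  show "tree_dist s t = tree_dist t s"
    by (simp add: tree_dist_def eq_commute[of s t] eq_commute[of "s _"])
  show "tree_dist s t = 0 \<longleftrightarrow> s = t" by (simp add: tree_dist_def)
  show "tree_dist s u \<le> tree_dist s t + tree_dist t u"
  proof (cases "s = u")
    case True
    then show ?thesis by (simp add: tree_dist_def)
  next
    case False
    then obtain n where n: "tree_dist s u = 1 / 2 ^ n"
      by (auto simp: tree_dist_def)
    have "\<not> (tree_dist s t < 1 / 2 ^ n \<and> tree_dist t u < 1 / 2 ^ n)"
    proof
      assume "tree_dist s t < 1 / 2 ^ n \<and> tree_dist t u < 1 / 2 ^ n"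
      then have "\<forall>w. length w \<le> n \<longrightarrow> s w = u w"
        unfolding tree_dist_less_iff by presburger
      then have "tree_dist s u < 1 / 2 ^ n"
        unfolding tree_dist_less_iff .
      with n show False by linarith
    qed
    moreover have "0 \<le> tree_dist s t" "0 \<le> tree_dist t u"
      by (simp_all add: tree_dist_def)
    ultimately show ?thesis using n by linarith
  qed
qed

definition tree_topology :: "'a set \<Rightarrow> 'a tree topology" where
  "tree_topology A = Metric_space.mtopology (trees A) tree_dist"

definition tree_borel :: "'a set \<Rightarrow> 'a tree set set" where
  "tree_borel A = sigma_sets (trees A) {U. openin (tree_topology A) U}"

text \<open>The letters \<open>\<exists>\<close> and \<open>\<forall>\<close> marking the owner of a position are the
  players \<open>Eve\<close> and \<open>Adam\<close> themselves.\<close>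

datatype player = Eve | Adam

definition game_alphabet :: "(player \<times> nat) set" where
  "game_alphabet = {Eve, Adam} \<times> {0, 1}"

type_synonym game_tree = "(player \<times> nat) tree"

text \<open>A play \<open>P\<close> is the infinite word of directions taken from the root, so the position
  reached after \<open>n\<close> moves is the word \<open>P 0 \<dots> P (n - 1)\<close>.\<close>

definition position :: "(nat \<Rightarrow> dir) \<Rightarrow> nat \<Rightarrow> dir list" where
  "position P n = map P [0..<n]"

text \<open>The values of a strategy at positions of the opponent are irrelevant. As the arena is a
  tree, the current position already determines the history of the play.\<close>

definition consistent ::
    "game_tree \<Rightarrow> player \<Rightarrow> (dir list \<Rightarrow> dir) \<Rightarrow> (nat \<Rightarrow> dir) \<Rightarrow> bool" where
  "consistent t p \<sigma> P \<longleftrightarrow>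
     (\<forall>n. fst (t (position P n)) = p \<longrightarrow> P n = \<sigma> (position P n))"

definition has_strategy :: "game_tree \<Rightarrow> player \<Rightarrow> ((nat \<Rightarrow> dir) \<Rightarrow> bool) \<Rightarrow> bool" where
  "has_strategy t p \<Phi> \<longleftrightarrow> (\<exists>\<sigma>. \<forall>P. consistent t p \<sigma> P \<longrightarrow> \<Phi> P)"

text \<open>Ranks are embedded into \<^typ>\<open>enat\<close>, since \<^const>\<open>limsup\<close> and \<^const>\<open>liminf\<close> need a
  complete lattice.\<close>

definition play_rank :: "game_tree \<Rightarrow> (nat \<Rightarrow> dir) \<Rightarrow> nat \<Rightarrow> enat" where
  "play_rank t P n = enat (snd (t (position P (Suc n))))"

definition W01 :: "game_tree set" where
  "W01 = {t \<in> trees game_alphabet. has_strategy t Eve (\<lambda>P. limsup (play_rank t P) = 0)}"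

definition W01' :: "game_tree set" where
  "W01' = {t \<in> trees game_alphabet. has_strategy t Adam (\<lambda>P. liminf (play_rank t P) = 1)}"

end

theory Submission imports Defs begin

text \<open>
  Call a map \<open>f\<close> on game trees \<^emph>\<open>contracting\<close> if the first \<open>n\<close> levels of \<open>t\<close> determine the first
  \<open>n + 1\<close> levels of \<open>f t\<close>, and say that \<open>f\<close> \<^emph>\<open>decides\<close> a set \<open>B\<close> if it sends every member of \<open>B\<close> into
  \<^const>\<open>W01\<close> and every other game tree into \<^const>\<open>W01'\<close>.

  Every Borel set \<open>B\<close> is decided by a contracting map (\<open>Borel_decidable\<close>). For open \<open>B\<close>, the tree
  \<open>f t\<close> announces by its colours whether the part of \<open>t\<close> seen so far already forces \<open>t \<in> B\<close>; for the
  complement, the players and the colours are exchanged, which swaps \<^const>\<open>W01\<close> and \<^const>\<open>W01'\<close>; for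
  a union of sets \<open>B\<^sub>k\<close>, Eve claims \<open>t \<in> B\<^sub>k\<close> for a \<open>k\<close> of her choice and enters the game that decides
  \<open>B\<^sub>k\<close>, and she sees only the colour \<open>1\<close> if she postpones her claim forever.

  Now suppose that a Borel set \<open>C\<close> separates the two languages, and let \<open>f\<close> be a contracting map that
  decides the complement of \<open>C\<close>. As in Banach's theorem, \<open>f\<close> has a fixed point \<open>t\<close>. If \<open>t \<in> C\<close> then
  \<open>t = f t\<close> lies in \<^const>\<open>W01'\<close>, which avoids \<open>C\<close>; if \<open>t \<notin> C\<close> then \<open>t = f t\<close> lies in \<^const>\<open>W01\<close>,
  which is part of \<open>C\<close>. Both are absurd.
\<close>

section \<open>Winning by reaching a constant colour\<close>

definition eventually_colour :: "game_tree \<Rightarrow> nat \<Rightarrow> (nat \<Rightarrow> dir) \<Rightarrow> bool" where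
  "eventually_colour t c P \<longleftrightarrow> (\<forall>\<^sub>F n in sequentially. snd (t (position P n)) = c)"

lemma limsup_enat_eq_0_iff:
  fixes r :: "nat \<Rightarrow> enat"
  shows "limsup r = 0 \<longleftrightarrow> (\<forall>\<^sub>F n in sequentially. r n = 0)"
proof
  assume "limsup r = 0"
  then have "\<forall>\<^sub>F n in sequentially. r n < 1"
    using Limsup_le_iff[of sequentially r 0] by auto
  then show "\<forall>\<^sub>F n in sequentially. r n = 0"
    by eventually_elim (simp add: one_eSuc)
next
  assume "\<forall>\<^sub>F n in sequentially. r n = 0"
  then have "limsup r = limsup (\<lambda>n. 0 :: enat)" by (rule Limsup_eq)
  then show "limsup r = 0" by (simp add: Limsup_const)
qed

lemma liminf_enat_eq_1_iff:
  fixes r :: "nat \<Rightarrow> enat"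
  assumes "\<And>n. r n \<le> 1"
  shows "liminf r = 1 \<longleftrightarrow> (\<forall>\<^sub>F n in sequentially. r n = 1)"
proof
  assume "liminf r = 1"
  then have "\<forall>\<^sub>F n in sequentially. 0 < r n"
    by (metis le_Liminf_iff order_refl zero_less_one)
  then show "\<forall>\<^sub>F n in sequentially. r n = 1"
    by eventually_elim (use assms in \<open>simp add: ileI1 one_eSuc order_antisym\<close>)
next
  assume "\<forall>\<^sub>F n in sequentially. r n = 1"
  then have "liminf r = liminf (\<lambda>n. 1 :: enat)" by (rule Liminf_eq)
  then show "liminf r = 1" by (simp add: Liminf_const)
qed

lemma game_tree_colour:
  assumes "t \<in> trees game_alphabet"
  shows "snd (t w) = 0 \<or> snd (t w) = 1"
proof -
  have "t w \<in> game_alphabet" using assms by (simp add: trees_def)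
  then show ?thesis by (cases "t w") (auto simp: game_alphabet_def)
qed

text \<open>
  The ranks of a play start with the position after the first move, so they skip the root; this shift
  does not affect the eventual colour.
\<close>

lemma W01_iff:
  "t \<in> W01 \<longleftrightarrow> t \<in> trees game_alphabet \<and> has_strategy t Eve (eventually_colour t 0)"
proof -
  have "limsup (play_rank t P) = 0 \<longleftrightarrow> eventually_colour t 0 P" for P
    unfolding limsup_enat_eq_0_iff
    unfolding play_rank_def eventually_colour_def zero_enat_def enat.inject
    by (rule eventually_sequentially_Suc[of "\<lambda>n. snd (t (position P n)) = 0"])
  then show ?thesis by (simp add: W01_def has_strategy_def)
qed

lemma W01'_iff:
  "t \<in> W01' \<longleftrightarrow> t \<in> trees game_alphabet \<and> has_strategy t Adam (eventually_colour t 1)"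
proof (cases "t \<in> trees game_alphabet")
  case True
  have "liminf (play_rank t P) = 1 \<longleftrightarrow> eventually_colour t 1 P" for P
  proof -
    have "play_rank t P n \<le> 1" for n
      using game_tree_colour[OF True, of "position P (Suc n)"]
      by (auto simp: play_rank_def one_enat_def zero_enat_def)
    then have "liminf (play_rank t P) = 1 \<longleftrightarrow> (\<forall>\<^sub>F n in sequentially. play_rank t P n = 1)"
      by (rule liminf_enat_eq_1_iff)
    also have "\<dots> \<longleftrightarrow> eventually_colour t 1 P"
      unfolding play_rank_def eventually_colour_def one_enat_def enat.inject
      by (rule eventually_sequentially_Suc[of "\<lambda>n. snd (t (position P n)) = 1"])
    finally show ?thesis .
  qed
  with True show ?thesis by (simp add: W01'_def has_strategy_def)
next
  case False
  then show ?thesis by (simp add: W01'_def)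
qed

section \<open>Contracting maps\<close>

definition agree :: "nat \<Rightarrow> 'a tree \<Rightarrow> 'a tree \<Rightarrow> bool" where
  "agree n s t \<longleftrightarrow> (\<forall>w. length w < n \<longrightarrow> s w = t w)"

definition contracting :: "'a set \<Rightarrow> ('a tree \<Rightarrow> 'a tree) \<Rightarrow> bool" where
  "contracting A f \<longleftrightarrow> f \<in> trees A \<rightarrow> trees A \<and>
     (\<forall>s \<in> trees A. \<forall>t \<in> trees A. \<forall>n. agree n s t \<longrightarrow> agree (Suc n) (f s) (f t))"

lemma contractingI:
  assumes "\<And>t. t \<in> trees A \<Longrightarrow> f t \<in> trees A"
    and "\<And>s t n. s \<in> trees A \<Longrightarrow> t \<in> trees A \<Longrightarrow> agree n s t \<Longrightarrow> agree (Suc n) (f s) (f t)"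
  shows "contracting A f"
  using assms by (auto simp: contracting_def)

lemma contracting_in_trees: "contracting A f \<Longrightarrow> t \<in> trees A \<Longrightarrow> f t \<in> trees A"
  by (auto simp: contracting_def)

lemma contracting_agree:
  "contracting A f \<Longrightarrow> s \<in> trees A \<Longrightarrow> t \<in> trees A \<Longrightarrow> agree n s t \<Longrightarrow> agree (Suc n) (f s) (f t)"
  by (auto simp: contracting_def)

text \<open>
  The iterates of \<open>f\<close> stabilise level by level, since one more application of \<open>f\<close> makes one more level
  independent of the starting tree. The fixed point reads each level off an iterate in which that level
  is already stable.
\<close>

lemma contracting_fixed_point:
  assumes f: "contracting A f" and "A \<noteq> {}"
  obtains t where "t \<in> trees A" and "f t = t"
proof -
  obtain a where "a \<in> A" using \<open>A \<noteq> {}\<close> by blast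
  define x where "x k = (f ^^ k) (\<lambda>_. a)" for k
  have x: "x k \<in> trees A" for k
    by (induction k)
      (use \<open>a \<in> A\<close> contracting_in_trees[OF f] in \<open>auto simp: x_def trees_def\<close>)
  have x_Suc: "x (Suc k) = f (x k)" for k by (simp add: x_def)
  have stable: "agree k (x k) (x (k + m))" for k m
    by (induction k)
      (use contracting_agree[OF f x x] in \<open>auto simp: x_Suc agree_def\<close>)
  define t where "t v = x (Suc (length v)) v" for v
  have t: "t \<in> trees A" using x by (simp add: t_def trees_def)
  have agree_t: "agree n t (x n)" for n
    unfolding agree_def
  proof (intro allI impI)
    fix v :: "dir list" assume "length v < n"
    then obtain m where "n = Suc (length v) + m" using less_iff_Suc_add by auto
    then show "t v = x n v"
      using stable[of "Suc (length v)" m] by (simp add: t_def agree_def)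
  qed
  have "f t v = t v" for v
  proof -
    have "agree (Suc (length v)) (f t) (x (Suc (length v)))"
      unfolding x_Suc by (rule contracting_agree[OF f t x agree_t])
    then show ?thesis by (simp add: agree_def t_def)
  qed
  then show thesis using that t by blast
qed

section \<open>Deciding sets of trees by games\<close>

definition decides :: "(game_tree \<Rightarrow> game_tree) \<Rightarrow> game_tree set \<Rightarrow> bool" where
  "decides f B \<longleftrightarrow> contracting game_alphabet f \<and>
     (\<forall>t \<in> trees game_alphabet. (t \<in> B \<longrightarrow> f t \<in> W01) \<and> (t \<notin> B \<longrightarrow> f t \<in> W01'))"

subsection \<open>Open sets\<close>

lemma openin_tree_topology_agree:
  assumes U: "openin (tree_topology A) U" and t: "t \<in> U"
  obtains n where "\<And>s. s \<in> trees A \<Longrightarrow> agree n s t \<Longrightarrow> s \<in> U"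
proof -
  interpret Metric_space "trees A" tree_dist by (rule Metric_space_tree_dist)
  have "U \<subseteq> trees A" and "\<exists>r>0. mball t r \<subseteq> U"
    using U t unfolding tree_topology_def openin_mtopology by blast+
  then obtain r where r: "r > 0" "mball t r \<subseteq> U" and tA: "t \<in> trees A"
    using t by blast
  obtain n where n: "(1 / 2 :: real) ^ n < r"
    using real_arch_pow_inv[OF \<open>r > 0\<close>, of "1 / 2"] by auto
  \<comment> \<open>Distance below \<open>2\<^sup>-\<^sup>n\<close> means agreement at depth \<open>n\<close> as well, hence on \<open>n + 1\<close> levels.\<close>
  have "s \<in> U" if s: "s \<in> trees A" and "agree (Suc n) s t" for s
  proof -
    have "tree_dist t s < 1 / 2 ^ n"
      unfolding tree_dist_less_iff using \<open>agree (Suc n) s t\<close> by (simp add: agree_def)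
    then have "s \<in> mball t r" using n s tA by (simp add: power_one_over)
    with r show ?thesis by blast
  qed
  then show thesis by (rule that)
qed

text \<open>
  At depth \<open>n\<close> the colour is \<open>0\<close> exactly when the first \<open>n\<close> levels of \<open>t\<close> already guarantee membership
  in \<open>U\<close>. Along every play this happens eventually if \<open>t \<in> U\<close> and never if \<open>t \<notin> U\<close>, so the moves are
  irrelevant.
\<close>

lemma open_decidable:
  assumes U: "openin (tree_topology game_alphabet) U"
  shows "\<exists>f. decides f U"
proof -
  define forced where
    "forced n t \<longleftrightarrow> (\<forall>s \<in> trees game_alphabet. agree n s t \<longrightarrow> s \<in> U)" for n t
  define f :: "game_tree \<Rightarrow> game_tree" where
    "f t w = (Eve, if forced (length w) t then 0 else 1)" for t w
  have f_trees: "f t \<in> trees game_alphabet" for t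
    by (auto simp: f_def trees_def game_alphabet_def)
  have forced_cong: "forced m s \<longleftrightarrow> forced m t" if "agree n s t" "m \<le> n" for m n s t
    using that by (auto simp: forced_def agree_def)
  have "agree (Suc n) (f s) (f t)" if "agree n s t" for n s t
    using forced_cong[OF that] by (auto simp: agree_def[of "Suc n"] f_def)
  then have contr: "contracting game_alphabet f"
    by (intro contractingI f_trees)
  have "f t \<in> W01" if t: "t \<in> U" for t
  proof -
    obtain n where n: "forced n t"
      using openin_tree_topology_agree[OF U t] unfolding forced_def by metis
    have "forced m t" if "m \<ge> n" for m
      using n that by (auto simp: forced_def agree_def)
    then have "eventually_colour (f t) 0 P" for P
      unfolding eventually_colour_def eventually_sequentially
      by (intro exI[of _ n]) (simp add: f_def position_def)
    then show ?thesis by (simp add: W01_iff f_trees has_strategy_def)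
  qed
  moreover have "f t \<in> W01'" if "t \<in> trees game_alphabet" "t \<notin> U" for t
  proof -
    have "\<not> forced n t" for n using that by (auto simp: forced_def agree_def)
    then have "eventually_colour (f t) 1 P" for P
      by (simp add: eventually_colour_def f_def)
    then show ?thesis by (simp add: W01'_iff f_trees has_strategy_def)
  qed
  ultimately show ?thesis using contr by (auto simp: decides_def)
qed

subsection \<open>Complements\<close>

fun opponent :: "player \<Rightarrow> player" where
  "opponent Eve = Adam"
| "opponent Adam = Eve"

definition dual :: "game_tree \<Rightarrow> game_tree" where
  "dual t w = (opponent (fst (t w)), 1 - snd (t w))"

lemma opponent_inject [simp]: "opponent p = opponent q \<longleftrightarrow> p = q"
  by (cases p; cases q) auto

lemma dual_in_trees: "dual t \<in> trees game_alphabet" if "t \<in> trees game_alphabet"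
  using game_tree_colour[OF that] player.exhaust
  by (auto simp: trees_def game_alphabet_def dual_def)

text \<open>
  Both games have the same moves, so the same strategy serves the player who takes over the positions.
\<close>

lemma dual_has_strategy:
  assumes "has_strategy t p (eventually_colour t c)"
  shows "has_strategy (dual t) (opponent p) (eventually_colour (dual t) (1 - c))"
proof -
  obtain \<sigma> where \<sigma>: "\<And>P. consistent t p \<sigma> P \<Longrightarrow> eventually_colour t c P"
    using assms by (auto simp: has_strategy_def)
  have "eventually_colour (dual t) (1 - c) P" if "consistent (dual t) (opponent p) \<sigma> P" for P
  proof -
    have "consistent t p \<sigma> P"
      using that by (simp add: consistent_def dual_def)
    then have "eventually_colour t c P" by (rule \<sigma>)
    then show ?thesis
      unfolding eventually_colour_def by eventually_elim (simp add: dual_def)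
  qed
  then show ?thesis by (auto simp: has_strategy_def)
qed

lemma dual_W01: "t \<in> W01 \<Longrightarrow> dual t \<in> W01'"
  using dual_has_strategy[of t Eve 0] by (auto simp: W01_iff W01'_iff dual_in_trees)

lemma dual_W01': "t \<in> W01' \<Longrightarrow> dual t \<in> W01"
  using dual_has_strategy[of t Adam 1] by (auto simp: W01_iff W01'_iff dual_in_trees)

lemma Compl_decidable:
  assumes "decides f B"
  shows "decides (\<lambda>t. dual (f t)) (trees game_alphabet - B)"
proof -
  have f: "contracting game_alphabet f" using assms by (simp add: decides_def)
  have "contracting game_alphabet (\<lambda>t. dual (f t))"
  proof (rule contractingI)
    show "dual (f t) \<in> trees game_alphabet" if "t \<in> trees game_alphabet" for t
      using contracting_in_trees[OF f that] by (rule dual_in_trees)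
    show "agree (Suc n) (dual (f s)) (dual (f t))"
      if "s \<in> trees game_alphabet" "t \<in> trees game_alphabet" "agree n s t" for s t n
      using contracting_agree[OF f that] by (simp add: agree_def dual_def)
  qed
  then show ?thesis
    using assms dual_W01 dual_W01' by (auto simp: decides_def)
qed

subsection \<open>Countable unions\<close>

text \<open>
  The tree with label \<open>a\<close> on its leftmost branch, from which \<open>T k\<close> hangs off to the right after \<open>k\<close>
  moves. It also serves to combine strategies for the trees \<open>T k\<close>, which have the same shape.
\<close>

primrec graft :: "'a \<Rightarrow> (nat \<Rightarrow> 'a tree) \<Rightarrow> dir list \<Rightarrow> 'a" where
  "graft a T [] = a"
| "graft a T (d # w) = (case d of D1 \<Rightarrow> graft a (\<lambda>k. T (Suc k)) w | D2 \<Rightarrow> T 0 w)"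

lemma graft_spine [simp]: "graft a T (replicate n D1) = a"
  by (induction n arbitrary: T) auto

lemma graft_exit [simp]: "graft a T (replicate n D1 @ D2 # w) = T n w"
  by (induction n arbitrary: T) auto

lemma graft_in_trees:
  assumes "a \<in> A" and "\<And>k. T k \<in> trees A"
  shows "graft a T \<in> trees A"
proof -
  have "graft a T w \<in> A" for w
    using assms(2) by (induction w arbitrary: T) (auto simp: assms(1) trees_def split: dir.split)
  then show ?thesis by (simp add: trees_def)
qed

lemma graft_agree:
  assumes "\<And>k. agree n (S k) (T k)"
  shows "agree n (graft a S) (graft a T)"
proof -
  have "graft a S w = graft a T w" if "length w < n" for w
    using assms that by (induction w arbitrary: S T) (auto simp: agree_def split: dir.split)
  then show ?thesis by (simp add: agree_def)
qed

lemma position_along_spine: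
  assumes "\<And>i. i < n \<Longrightarrow> P i = D1"
  shows "position P n = replicate n D1"
  using assms by (auto simp: position_def intro: nth_equalityI)

lemma position_after_exit:
  assumes "\<And>i. i < n \<Longrightarrow> P i = D1" and "P n = D2"
  shows "position P (m + Suc n) = replicate n D1 @ D2 # position (\<lambda>i. P (i + Suc n)) m"
proof -
  have "position P (m + Suc n) = position P n @ P n # position (\<lambda>i. P (i + Suc n)) m"
    by (induction m) (simp_all add: position_def)
  then show ?thesis using assms position_along_spine[of n P] by simp
qed

text \<open>
  After leaving the leftmost branch at level \<open>n\<close>, a play of the grafted tree is a play of \<open>T n\<close>; the
  finitely many positions before it do not affect the eventual colour.
\<close>

lemma graft_play_after_exit:
  assumes spine: "\<And>i. i < n \<Longrightarrow> P i = D1" and exit: "P n = D2"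
    and cons: "consistent (graft a T) p \<tau> P"
    and \<tau>: "\<And>w. \<tau> (replicate n D1 @ D2 # w) = \<sigma> w"
    and win: "\<And>Q. consistent (T n) p \<sigma> Q \<Longrightarrow> eventually_colour (T n) c Q"
  shows "eventually_colour (graft a T) c P"
proof -
  define Q where "Q = (\<lambda>i. P (i + Suc n))"
  have pos: "position P (m + Suc n) = replicate n D1 @ D2 # position Q m" for m
    unfolding Q_def using spine exit by (rule position_after_exit)
  have "consistent (T n) p \<sigma> Q"
    unfolding consistent_def
  proof (intro allI impI)
    fix m assume "fst (T n (position Q m)) = p"
    then have "fst (graft a T (position P (m + Suc n))) = p" by (simp only: pos graft_exit)
    then have "P (m + Suc n) = \<tau> (position P (m + Suc n))"
      using cons unfolding consistent_def by blast
    then show "Q m = \<sigma> (position Q m)" by (simp only: pos \<tau>) (simp add: Q_def)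
  qed
  then have "\<forall>\<^sub>F m in sequentially. snd (graft a T (position P (m + Suc n))) = c"
    unfolding pos graft_exit using win unfolding eventually_colour_def by blast
  then show ?thesis
    unfolding eventually_colour_def
    by (rule eventually_sequentially_seg[THEN iffD1])
qed

lemma graft_W01:
  assumes trees: "\<And>k. T k \<in> trees game_alphabet" and n: "T n \<in> W01"
  shows "graft (Eve, 1) T \<in> W01"
proof -
  obtain \<sigma> where \<sigma>: "\<And>P. consistent (T n) Eve \<sigma> P \<Longrightarrow> eventually_colour (T n) 0 P"
    using n by (auto simp: W01_iff has_strategy_def)
  \<comment> \<open>Eve walks down the leftmost branch, leaves it at level \<open>n\<close>, and then plays \<open>\<sigma>\<close>.\<close>
  define \<tau> where "\<tau> w = (if w = replicate n D1 then D2 else graft D1 (\<lambda>_. \<sigma>) w)" for w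
  have "eventually_colour (graft (Eve, 1) T) 0 P" if P: "consistent (graft (Eve, 1) T) Eve \<tau> P" for P
  proof -
    have move: "P k = \<tau> (replicate k D1)" if "\<And>i. i < k \<Longrightarrow> P i = D1" for k
      using P[unfolded consistent_def, rule_format, of k]
      by (simp add: position_along_spine[OF that])
    have spine: "P i = D1" if "i < n" for i
      using that
    proof (induction i rule: less_induct)
      case (less i)
      then have "P i = \<tau> (replicate i D1)" by (intro move) auto
      with less.prems show ?case by (simp add: \<tau>_def)
    qed
    moreover have "P n = D2" using move[OF spine] by (simp add: \<tau>_def)
    moreover have "\<tau> (replicate n D1 @ D2 # w) = \<sigma> w" for w
    proof -
      have "replicate n D1 @ D2 # w \<noteq> replicate n D1"
        by (metis append_self_conv list.distinct(1))
      then show ?thesis by (simp add: \<tau>_def)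
    qed
    ultimately show ?thesis using P \<sigma> by (intro graft_play_after_exit)
  qed
  moreover have "graft (Eve, 1) T \<in> trees game_alphabet"
    by (intro graft_in_trees trees) (simp add: game_alphabet_def)
  ultimately show ?thesis by (auto simp: W01_iff has_strategy_def)
qed

text \<open>
  Adam answers each exit with his strategy for the tree that is entered there. A play that never leaves
  the leftmost branch shows him the colour \<open>1\<close> throughout.
\<close>

lemma graft_W01':
  assumes all: "\<And>k. T k \<in> W01'"
  shows "graft (Eve, 1) T \<in> W01'"
proof -
  have "\<exists>\<sigma>. \<forall>P. consistent (T k) Adam \<sigma> P \<longrightarrow> eventually_colour (T k) 1 P" for k
    using all[of k] by (simp add: W01'_iff has_strategy_def)
  then obtain \<sigma> where
    \<sigma>: "\<And>k P. consistent (T k) Adam (\<sigma> k) P \<Longrightarrow> eventually_colour (T k) 1 P"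
    by metis
  have "eventually_colour (graft (Eve, 1) T) 1 P"
    if P: "consistent (graft (Eve, 1) T) Adam (graft D1 \<sigma>) P" for P
  proof (cases "\<exists>n. P n = D2")
    case True
    define n where "n = (LEAST n. P n = D2)"
    have "P n = D2" unfolding n_def using True by (rule LeastI_ex)
    moreover have "P i = D1" if "i < n" for i
      using not_less_Least[OF that[unfolded n_def]] dir.exhaust by blast
    ultimately show ?thesis using P \<sigma> by (intro graft_play_after_exit) auto
  next
    case False
    then have "P i = D1" for i using dir.exhaust by blast
    then have "position P n = replicate n D1" for n by (simp add: position_along_spine)
    then show ?thesis by (simp add: eventually_colour_def)
  qed
  moreover have "graft (Eve, 1) T \<in> trees game_alphabet"
    by (rule graft_in_trees) (use all in \<open>auto simp: game_alphabet_def W01'_iff\<close>)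
  ultimately show ?thesis by (auto simp: W01'_iff has_strategy_def)
qed

lemma Union_decidable:
  assumes f: "\<And>k :: nat. decides (f k) (B k)"
  shows "decides (\<lambda>t. graft (Eve, 1) (\<lambda>k. f k t)) (\<Union>k. B k)"
proof -
  have contr: "contracting game_alphabet (f k)" for k using f by (simp add: decides_def)
  have "contracting game_alphabet (\<lambda>t. graft (Eve, 1) (\<lambda>k. f k t))"
  proof (rule contractingI)
    show "graft (Eve, 1) (\<lambda>k. f k t) \<in> trees game_alphabet" if "t \<in> trees game_alphabet" for t
      by (intro graft_in_trees contracting_in_trees[OF contr that]) (simp add: game_alphabet_def)
    show "agree (Suc n) (graft (Eve, 1) (\<lambda>k. f k s)) (graft (Eve, 1) (\<lambda>k. f k t))"
      if "s \<in> trees game_alphabet" "t \<in> trees game_alphabet" "agree n s t" for s t n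
      using contracting_agree[OF contr that] by (rule graft_agree)
  qed
  moreover have "graft (Eve, 1) (\<lambda>k. f k t) \<in> W01" if "t \<in> trees game_alphabet" "t \<in> B n" for t n
    by (rule graft_W01[where n = n])
      (use f that contracting_in_trees[OF contr] in \<open>auto simp: decides_def\<close>)
  moreover have "graft (Eve, 1) (\<lambda>k. f k t) \<in> W01'"
    if "t \<in> trees game_alphabet" "t \<notin> (\<Union>k. B k)" for t
    by (rule graft_W01') (use f that in \<open>auto simp: decides_def\<close>)
  ultimately show ?thesis by (auto simp: decides_def)
qed

section \<open>Borel sets and the diagonal argument\<close>

lemma Borel_decidable:
  assumes "B \<in> tree_borel game_alphabet"
  shows "\<exists>f. decides f B"
  using assms unfolding tree_borel_def
proof (induction rule: sigma_sets.induct)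
  case (Basic U)
  then show ?case by (auto intro: open_decidable)
next
  case Empty
  show ?case by (simp add: open_decidable)
next
  case (Compl B)
  then show ?case by (blast intro: Compl_decidable)
next
  case (Union B)
  then obtain f where "\<And>k. decides (f k) (B k)" by metis
  then show ?case by (blast intro: Union_decidable)
qed

theorem theorem2p1:
  "\<not> (\<exists>C \<in> tree_borel game_alphabet. W01 \<subseteq> C \<and> C \<subseteq> trees game_alphabet - W01')"
proof
  assume "\<exists>C \<in> tree_borel game_alphabet. W01 \<subseteq> C \<and> C \<subseteq> trees game_alphabet - W01'"
  then obtain C where C: "C \<in> tree_borel game_alphabet"
    and sep: "W01 \<subseteq> C" "C \<subseteq> trees game_alphabet - W01'" by blast
  obtain f where "decides f C" using Borel_decidable[OF C] by blast
  then obtain g where g: "decides g (trees game_alphabet - C)"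
    using Compl_decidable by blast
  have "contracting game_alphabet g" using g by (simp add: decides_def)
  moreover have "game_alphabet \<noteq> {}" by (auto simp: game_alphabet_def)
  ultimately obtain t where t: "t \<in> trees game_alphabet" "g t = t"
    by (rule contracting_fixed_point)
  show False
  proof (cases "t \<in> C")
    case True
    then have "t \<in> W01'" using g t by (force simp: decides_def)
    with True sep show False by blast
  next
    case False
    then have "t \<in> W01" using g t by (force simp: decides_def)
    with False sep show False by blast
  qed
qed

end
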